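(* Let $p$ and $q$ be two probability densities (the standard densities) and, for $(l,s)\in\mathbb{R}\times(0,\infty)$, let $p_{l,s}(x)=\frac{1}{s}p\left(\frac{x-l}{s}\right)$ and $q_{l,s}(x)=\frac{1}{s}q\left(\frac{x-l}{s}\right)$ be the densities of the two associated location-scale families, which are assumed to share the same support $\mathcal{X}$. Let $f$ be a convex function on $(0,\infty)$, strictly convex at $1$, with $f(1)=0$. Then for all $(l_1,s_1),(l_2,s_2)\in\mathbb{R}\times(0,\infty)$, $$I_f(p_{l_1,s_1}:q_{l_2,s_2})=I_f\left(p:q_{\frac{l_2-l_1}{s_1},\frac{s_2}{s_1}}\right)=I_f\left(p_{\frac{l_1-l_2}{s_2},\frac{s_1}{s_2}}:q\right).$$
   Context: All densities are probability densities with respect to Lebesgue measure on $\mathbb{R}$. A density has support $\mathcal{X}\subseteq\mathbb{R}$ if it is positive on $\mathcal{X}$ and zero outside; the two location-scale families share the same support $\mathcal{X}$ means that all their members have support $\mathcal{X}$. For two densities $p,q$ with support $\mathcal{X}$, the $f$-divergence is $I_f(p:q)=\int_{\mathcal{X}}p(x)\,f\left(\frac{q(x)}{p(x)}\right)dx\in[0,+\infty]$. *)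

theory Defs
  imports "HOL-Analysis.Analysis"
begin

definition probability_density :: "(real \<Rightarrow> real) \<Rightarrow> bool" where
  "probability_density p \<longleftrightarrow>
     p \<in> borel_measurable lebesgue \<and> (\<forall>x. 0 \<le> p x) \<and> (\<integral>\<^sup>+x. ennreal (p x) \<partial>lebesgue) = 1"

definition has_support :: "(real \<Rightarrow> real) \<Rightarrow> real set \<Rightarrow> bool" where
  "has_support p X \<longleftrightarrow> (\<forall>x\<in>X. 0 < p x) \<and> (\<forall>x. x \<notin> X \<longrightarrow> p x = 0)"

definition loc_scale :: "(real \<Rightarrow> real) \<Rightarrow> real \<Rightarrow> real \<Rightarrow> real \<Rightarrow> real" where
  "loc_scale p l s x = (1 / s) * p ((x - l) / s)"

definition strictly_convex_at :: "(real \<Rightarrow> real) \<Rightarrow> real \<Rightarrow> bool" where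
  "strictly_convex_at f a \<longleftrightarrow>
     (\<forall>x>0. \<forall>y>0. \<forall>t. x \<noteq> y \<and> 0 < t \<and> t < 1 \<and> (1 - t) * x + t * y = a
        \<longrightarrow> f a < (1 - t) * f x + t * f y)"

text \<open>The integrand of the \<open>f\<close>-divergence may take negative values and the integral may be
  infinite, so it is written as the extended-real Lebesgue integral: integral of the positive part
  minus integral of the negative part (\<^const>\<open>ennreal\<close> sends negative reals to 0).
  For convex \<open>f\<close> on \<open>(0,\<infinity>)\<close> with \<open>f 1 = 0\<close> and densities \<open>p\<close>, \<open>q\<close> with support \<open>X\<close>, a supporting
  line of \<open>f\<close> at 1 gives \<open>p f(q/p) \<ge> c (q - p)\<close> on \<open>X\<close> for some real \<open>c\<close>; hence the subtracted
  integral is finite and the value lies in \<open>[0,\<infinity>]\<close>.\<close>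

definition f_divergence ::
    "(real \<Rightarrow> real) \<Rightarrow> real set \<Rightarrow> (real \<Rightarrow> real) \<Rightarrow> (real \<Rightarrow> real) \<Rightarrow> ereal" where
  "f_divergence f X p q =
     enn2ereal (\<integral>\<^sup>+x\<in>X. ennreal (p x * f (q x / p x)) \<partial>lebesgue)
     - enn2ereal (\<integral>\<^sup>+x\<in>X. ennreal (- (p x * f (q x / p x))) \<partial>lebesgue)"

end

theory Submission
  imports Defs
begin

text \<open>For \<open>s > 0\<close> the operator \<open>p \<mapsto> loc_scale p l s\<close> is the density form of pushing a measure
  forward along \<open>x \<mapsto> l + s x\<close>, so these operators compose like the affine maps themselves
  (\<open>loc_scale_loc_scale\<close>). The claim then rests on one invariance: transforming both densities by
  the same affine map does not change the divergence (\<open>f_divergence_loc_scale\<close>), because in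
  \<open>p f(q/p)\<close> the factors \<open>1/s\<close> cancel inside \<open>f\<close>, and the one left outside is the Jacobian of the
  substitution. Undoing the map \<open>(l1, s1)\<close> on both sides gives the first equality, undoing
  \<open>(l2, s2)\<close> the second.

  Two points make this rigorous. A support shared by a whole location-scale family is
  invariant under translations, so it is empty or the whole line, and a density cannot vanish
  everywhere; hence \<open>X\<close> is the whole line. The substitution needs a measurable integrand, which
  holds because a convex function on an open interval is continuous.\<close>

lemma loc_scale_loc_scale:
  "loc_scale (loc_scale h l s) l' s' = loc_scale h (l' + s' * l) (s' * s)" if "s \<noteq> 0" "s' \<noteq> 0"
proof
  fix x
  have "((x - l') / s' - l) / s = (x - (l' + s' * l)) / (s' * s)"
    using that by (simp add: field_simps)
  then show "loc_scale (loc_scale h l s) l' s' x = loc_scale h (l' + s' * l) (s' * s) x"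
    by (simp add: loc_scale_def)
qed

lemma loc_scale_0_1 [simp]: "loc_scale h 0 1 = h"
  by (simp add: loc_scale_def fun_eq_iff)

lemma loc_scale_measurable:
  assumes "h \<in> borel_measurable lebesgue" "s \<noteq> 0"
  shows "loc_scale h l s \<in> borel_measurable lebesgue"
proof -
  have "(\<lambda>x::real. - l / s + (\<Sum>j\<in>Basis. (1 / s * (x \<bullet> j)) *\<^sub>R j)) \<in> lebesgue \<rightarrow>\<^sub>M lebesgue"
    using assms by (intro lebesgue_affine_measurable) auto
  also have "(\<lambda>x::real. - l / s + (\<Sum>j\<in>Basis. (1 / s * (x \<bullet> j)) *\<^sub>R j)) = (\<lambda>x. (x - l) / s)"
    by (simp add: fun_eq_iff diff_divide_distrib)
  finally have "(\<lambda>x. h ((x - l) / s)) \<in> borel_measurable lebesgue"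
    using assms(1) by (rule measurable_compose)
  then show ?thesis
    unfolding loc_scale_def by measurable
qed

lemma nn_integral_loc_scale:
  assumes h: "h \<in> borel_measurable lebesgue" and s: "0 < s"
  shows "(\<integral>\<^sup>+x. ennreal (loc_scale h l s x) \<partial>lebesgue) = (\<integral>\<^sup>+x. ennreal (h x) \<partial>lebesgue)"
proof -
  have [measurable]: "loc_scale h l s \<in> borel_measurable lebesgue"
    using h s by (simp add: loc_scale_measurable)
  have aff: "(\<lambda>x::real. l + s * x) \<in> lebesgue \<rightarrow>\<^sub>M lebesgue"
    using lebesgue_affine_measurable[of "\<lambda>_. s" l] s by simp
  have [measurable]: "(\<lambda>x. loc_scale h l s (l + s * x)) \<in> borel_measurable lebesgue"
    by (rule measurable_compose[OF aff]) measurable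
  have "(\<integral>\<^sup>+x. ennreal (loc_scale h l s x) \<partial>lebesgue)
      = (\<integral>\<^sup>+x. ennreal (loc_scale h l s x)
           \<partial>density (distr lebesgue lebesgue (\<lambda>x. l + s * x)) (\<lambda>_. ennreal \<bar>s\<bar>))"
    using lebesgue_real_affine[of s l] s by simp
  also have "\<dots> = (\<integral>\<^sup>+x. ennreal s * ennreal (loc_scale h l s (l + s * x)) \<partial>lebesgue)"
    using aff s by (simp add: nn_integral_density nn_integral_distr nn_integral_cmult)
  also have "\<dots> = (\<integral>\<^sup>+x. ennreal (h x) \<partial>lebesgue)"
    using s by (intro nn_integral_cong) (simp add: loc_scale_def flip: ennreal_mult')
  finally show ?thesis .
qed

text \<open>Translations act transitively on the line, so one point of the support brings in all others,
  and total mass 1 provides that point.\<close>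

lemma common_support_UNIV:
  assumes "probability_density p"
    and supp: "\<And>l. has_support (loc_scale p l 1) X"
  shows "X = UNIV"
proof -
  have "\<exists>a. p a \<noteq> 0"
  proof (rule ccontr)
    assume "\<nexists>a. p a \<noteq> 0"
    then have "p = (\<lambda>_. 0)"
      by auto
    then show False
      using assms(1) by (simp add: probability_density_def)
  qed
  then obtain a where a: "p a \<noteq> 0" ..
  have "x \<in> X" for x
    using supp[of "x - a"] a by (auto simp: has_support_def loc_scale_def)
  then show ?thesis
    by auto
qed

lemma convex_on_compose_measurable:
  fixes f :: "real \<Rightarrow> real"
  assumes "convex_on {0<..} f" and r: "r \<in> borel_measurable M" "\<And>x. 0 < r x"
  shows "(\<lambda>x. f (r x)) \<in> borel_measurable M"
proof -
  have "continuous_on {0<..} f"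
    using assms(1) by (intro convex_on_continuous) auto
  then have "(\<lambda>t. if t \<in> {0<..} then f t else 0) \<in> borel_measurable borel"
    by (intro borel_measurable_continuous_on_if) auto
  from measurable_compose[OF r(1) this] show ?thesis
    using r(2) by simp
qed

lemma f_divergence_loc_scale:
  assumes p: "p \<in> borel_measurable lebesgue" "\<And>x. 0 < p x"
    and q: "q \<in> borel_measurable lebesgue" "\<And>x. 0 < q x"
    and f: "convex_on {0<..} f" and s: "0 < s"
  shows "f_divergence f UNIV (loc_scale p l s) (loc_scale q l s) = f_divergence f UNIV p q"
proof -
  define h where "h = (\<lambda>x. p x * f (q x / p x))"
  have "(\<lambda>x. q x / p x) \<in> borel_measurable lebesgue"
    using q(1) p(1) by (rule borel_measurable_divide)
  then have ratio: "(\<lambda>x. f (q x / p x)) \<in> borel_measurable lebesgue"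
    by (rule convex_on_compose_measurable[OF f]) (simp add: p q)
  have h: "h \<in> borel_measurable lebesgue"
    unfolding h_def using p(1) ratio by (rule borel_measurable_times)
  \<comment> \<open>The integrand, negative values included, transforms like a density; its positive and
      negative parts can then be treated separately.\<close>
  have eq: "loc_scale p l s x * f (loc_scale q l s x / loc_scale p l s x) = loc_scale h l s x" for x
    using s by (simp add: loc_scale_def h_def)
  have neg: "- loc_scale h l s x = loc_scale (\<lambda>x. - h x) l s x" for x
    by (simp add: loc_scale_def)
  have "f_divergence f UNIV (loc_scale p l s) (loc_scale q l s)
      = enn2ereal (\<integral>\<^sup>+x. ennreal (h x) \<partial>lebesgue) - enn2ereal (\<integral>\<^sup>+x. ennreal (- h x) \<partial>lebesgue)"
    unfolding f_divergence_def eq neg using s h by (simp add: nn_integral_loc_scale)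
  also have "\<dots> = f_divergence f UNIV p q"
    by (simp add: f_divergence_def h_def)
  finally show ?thesis .
qed

theorem theorem2:
  fixes p q f :: "real \<Rightarrow> real" and X :: "real set"
  assumes "probability_density p" and "probability_density q"
    and "\<And>l s. 0 < s \<Longrightarrow> has_support (loc_scale p l s) X"
    and "\<And>l s. 0 < s \<Longrightarrow> has_support (loc_scale q l s) X"
    and "convex_on {0<..} f" and "strictly_convex_at f 1" and "f 1 = 0"
  shows "\<forall>l1 s1 l2 s2. 0 < s1 \<and> 0 < s2 \<longrightarrow>
      f_divergence f X (loc_scale p l1 s1) (loc_scale q l2 s2)
        = f_divergence f X p (loc_scale q ((l2 - l1) / s1) (s2 / s1))
    \<and> f_divergence f X p (loc_scale q ((l2 - l1) / s1) (s2 / s1))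
        = f_divergence f X (loc_scale p ((l1 - l2) / s2) (s1 / s2)) q"
proof (intro allI impI)
  fix l1 s1 l2 s2 :: real
  assume "0 < s1 \<and> 0 < s2"
  then have s: "0 < s1" "0 < s2"
    by auto
  have X: "X = UNIV"
    using assms(1,3) by (intro common_support_UNIV) auto
  have p: "loc_scale p l s \<in> borel_measurable lebesgue" "0 < loc_scale p l s x"
    and q: "loc_scale q l s \<in> borel_measurable lebesgue" "0 < loc_scale q l s x"
    if "0 < s" for l s x
    using assms(1-4) that X
    by (auto simp: probability_density_def has_support_def loc_scale_measurable)
  have inv: "f_divergence f X (loc_scale (loc_scale p a b) l s) (loc_scale (loc_scale q c d) l s)
      = f_divergence f X (loc_scale p a b) (loc_scale q c d)"
    if "0 < b" "0 < d" "0 < s" for a b c d l s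
    unfolding X using that p q assms(5) by (intro f_divergence_loc_scale) auto
  have 1: "f_divergence f X (loc_scale p l1 s1) (loc_scale q l2 s2)
      = f_divergence f X p (loc_scale q ((l2 - l1) / s1) (s2 / s1))"
    using inv[of 1 "s2 / s1" s1 0 l1 "(l2 - l1) / s1"] s by (simp add: loc_scale_loc_scale)
  have 2: "f_divergence f X (loc_scale p l1 s1) (loc_scale q l2 s2)
      = f_divergence f X (loc_scale p ((l1 - l2) / s2) (s1 / s2)) q"
    using inv[of "s1 / s2" 1 s2 "(l1 - l2) / s2" l2 0] s by (simp add: loc_scale_loc_scale)
  show "f_divergence f X (loc_scale p l1 s1) (loc_scale q l2 s2)
        = f_divergence f X p (loc_scale q ((l2 - l1) / s1) (s2 / s1))
    \<and> f_divergence f X p (loc_scale q ((l2 - l1) / s1) (s2 / s1))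
        = f_divergence f X (loc_scale p ((l1 - l2) / s2) (s1 / s2)) q"
    using 1 2 by simp
qed

end
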